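(* Let $X=\prod_{i\in\mathbb{N}}X_i$ be a countable product of almost discrete (Tychonoff) spaces. Then $X$ is a Grothendieck space if and only if $t(X)=\omega$ and $X$ is Lindelöf.
   Context: A space is almost discrete if it has exactly one non-isolated point. $C_p(X)$ is the space of continuous real-valued functions on $X$ with the pointwise convergence topology. A space $Z$ is a $g$-space if every subset $A\subseteq Z$ such that every infinite subset of $A$ has an accumulation point in $Z$ has compact closure in $Z$. $X$ is Grothendieck if every subspace of $C_p(X)$ is a $g$-space. $t(X)$ denotes the tightness of $X$. *)

theory Defs
  imports "HOL-Analysis.Analysis"
begin

definition tychonoff_space :: "'a topology \<Rightarrow> bool" where
  "tychonoff_space X \<longleftrightarrow> completely_regular_space X \<and> t1_space X"

definition almost_discrete :: "'a topology \<Rightarrow> bool" where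
  "almost_discrete X \<longleftrightarrow> (\<exists>!p. p \<in> topspace X \<and> \<not> openin X {p})"

definition Cp :: "'a topology \<Rightarrow> ('a \<Rightarrow> real) topology" where
  "Cp X = subtopology (product_topology (\<lambda>_. euclideanreal) (topspace X))
            {f \<in> extensional (topspace X). continuous_map X euclideanreal f}"

definition g_space :: "'a topology \<Rightarrow> bool" where
  "g_space Z \<longleftrightarrow> (\<forall>A. A \<subseteq> topspace Z \<longrightarrow>
      (\<forall>B. B \<subseteq> A \<and> infinite B \<longrightarrow> Z derived_set_of B \<noteq> {}) \<longrightarrow>
      compactin Z (Z closure_of A))"

definition grothendieck :: "'a topology \<Rightarrow> bool" where
  "grothendieck X \<longleftrightarrow> (\<forall>S. S \<subseteq> topspace (Cp X) \<longrightarrow> g_space (subtopology (Cp X) S))"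

definition countable_tightness :: "'a topology \<Rightarrow> bool" where
  "countable_tightness X \<longleftrightarrow> (\<forall>A x. A \<subseteq> topspace X \<and> x \<in> X closure_of A \<longrightarrow>
      (\<exists>B. B \<subseteq> A \<and> countable B \<and> x \<in> X closure_of B))"

end

theory Submission
  imports Defs
begin

text \<open>Let \<open>p i\<close> be the non-isolated point of \<open>X i\<close>. In a Grothendieck space a disjoint family of nonempty
  sets all of whose countable subunions are clopen is countable. This forces the neighbourhoods of
  \<open>p i\<close> to be cocountable, and it yields countable tightness of the finite subproducts, hence of the
  product. Cocountability of the neighbourhoods is equivalent to the product being Lindelof by a
  closing-off argument with the retractions \<open>collapse M\<close>, which replace by \<open>p i\<close> every coordinate outside
  a countable set \<open>M\<close>.

  Conversely, let \<open>A\<close> be countably compact in a subspace \<open>S\<close> of \<open>Cp P\<close> and \<open>f\<close> a pointwise limit point of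
  \<open>A\<close>. Tightness makes \<open>f\<close> continuous. Every continuous function is invariant under \<open>collapse M\<close> for some
  countable \<open>M\<close>; closing off gives a single \<open>M\<close> and a sequence in \<open>A\<close>, all of it and \<open>f\<close> invariant under
  \<open>collapse M\<close>, that converges to \<open>f\<close> on a countable dense subset of the image of \<open>collapse M\<close>. Any cluster
  point of the sequence in \<open>S\<close> then equals \<open>f\<close>, so \<open>f \<in> S\<close>.\<close>

section \<open>Countable closing-off\<close>

lemma countable_closing_off:
  fixes h :: "'b set \<Rightarrow> 'b set"
  assumes h: "\<And>F. finite F \<Longrightarrow> countable (h F)" and "countable M0"
  obtains M where "countable M" "M0 \<subseteq> M" "\<And>F. \<lbrakk>finite F; F \<subseteq> M\<rbrakk> \<Longrightarrow> h F \<subseteq> M"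
proof -
  \<comment> \<open>A countable set has only countably many finite subsets, so every stage stays
    countable; a finite subset of the union of all stages already lies in one of them.\<close>
  define N where "N = rec_nat M0 (\<lambda>_ M. M \<union> (\<Union>F\<in>{F. finite F \<and> F \<subseteq> M}. h F))"
  have N0: "N 0 = M0" and NS: "N (Suc n) = N n \<union> (\<Union>F\<in>{F. finite F \<and> F \<subseteq> N n}. h F)" for n
    by (auto simp: N_def)
  have "countable (N n)" for n
  proof (induction n)
    case 0
    then show ?case using assms by (simp add: N0)
  next
    case (Suc n)
    then show ?case unfolding NS
      by (intro countable_Un countable_UN countable_Collect_finite_subset) (auto intro: h)
  qed
  moreover have mono: "N m \<subseteq> N n" if "m \<le> n" for m n
    by (rule lift_Suc_mono_le[OF _ that]) (simp add: NS)
  moreover have "h F \<subseteq> (\<Union>n. N n)" if F: "finite F" "F \<subseteq> (\<Union>n. N n)" for F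
  proof -
    have "\<exists>n. F \<subseteq> N n"
      using F
    proof (induction F)
      case (insert x F)
      then obtain n m where "F \<subseteq> N n" "x \<in> N m" by auto
      then have "insert x F \<subseteq> N (max m n)"
        using mono[of m "max m n"] mono[of n "max m n"] by auto
      then show ?case by blast
    qed auto
    then obtain n where "F \<subseteq> N n" by blast
    then have "h F \<subseteq> N (Suc n)" using F by (auto simp: NS)
    then show ?thesis by blast
  qed
  ultimately show ?thesis
    using N0 by (intro that[of "\<Union>n. N n"]) auto
qed

section \<open>Pointwise convergence\<close>

abbreviation pointwise :: "'b set \<Rightarrow> ('b \<Rightarrow> real) topology" where
  "pointwise T \<equiv> product_topology (\<lambda>_. euclideanreal) T"

lemma topspace_Cp: "topspace (Cp Z) = {f \<in> extensional (topspace Z). continuous_map Z euclideanreal f}"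
  by (auto simp: Cp_def PiE_def)

text \<open>Moves subspaces of \<open>Cp Z\<close> into the full power of the reals, where pointwise
  bounded sets have compact closure by Tychonoff's theorem.\<close>

lemma subtopology_Cp:
  "S \<subseteq> topspace (Cp Z) \<Longrightarrow> subtopology (Cp Z) S = subtopology (pointwise (topspace Z)) S"
  unfolding topspace_Cp by (simp add: Cp_def subtopology_subtopology inf_absorb2)

lemma Hausdorff_pointwise: "Hausdorff_space (pointwise T)"
  by (simp add: Hausdorff_space_product_topology)

lemma openin_pointwise_ball:
  assumes "finite F" "F \<subseteq> T"
  shows "openin (pointwise T) {g \<in> extensional T. \<forall>x\<in>F. \<bar>g x - f x\<bar> < e}"
proof -
  have "{g \<in> extensional T. \<forall>x\<in>F. \<bar>g x - f x\<bar> < e} =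
        (\<Pi>\<^sub>E x\<in>T. if x \<in> F then ball (f x) e else UNIV)"
    using assms by (auto simp: PiE_def Pi_def dist_real_def abs_minus_commute split: if_splits)
  moreover have "finite {x \<in> T. (if x \<in> F then ball (f x) e else UNIV) \<noteq> UNIV}"
    by (rule finite_subset[OF _ assms(1)]) auto
  ultimately show ?thesis
    by (simp add: openin_PiE_gen)
qed

lemma in_closure_pointwiseD:
  assumes "f \<in> pointwise T closure_of A" "finite F" "F \<subseteq> T" "e > 0"
  shows "\<exists>g\<in>A. \<forall>x\<in>F. \<bar>g x - f x\<bar> < e"
proof -
  have f: "f \<in> extensional T"
    using assms(1) by (auto simp: in_closure_of PiE_def)
  define U where "U = {g \<in> extensional T. \<forall>x\<in>F. \<bar>g x - f x\<bar> < e}"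
  have "openin (pointwise T) U"
    unfolding U_def by (rule openin_pointwise_ball[OF assms(2,3)])
  moreover have "f \<in> U"
    using assms(4) f by (simp add: U_def)
  ultimately obtain g where "g \<in> A" "g \<in> U"
    using assms(1) unfolding in_closure_of by blast
  then show ?thesis by (auto simp: U_def)
qed

text \<open>The finite sets \<open>F n\<close> exhaust \<open>C\<close>, and \<open>g n\<close> is
  chosen within \<open>1 / (n + 1)\<close> of \<open>f\<close> on \<open>F n\<close>.\<close>

lemma in_closure_pointwise_sequence:
  assumes f: "f \<in> pointwise T closure_of A" and C: "countable C" "C \<subseteq> T"
  obtains g :: "nat \<Rightarrow> 'b \<Rightarrow> real" where "\<And>n. g n \<in> A" "\<And>x. x \<in> C \<Longrightarrow> (\<lambda>n. g n x) \<longlonglongrightarrow> f x"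
proof -
  define F where "F n = C \<inter> to_nat_on C -` {..n}" for n
  have "finite (F n)" for n
    using C unfolding F_def Int_commute[of C] by (intro finite_vimage_IntI) auto
  moreover have "F n \<subseteq> T" for n using C by (auto simp: F_def)
  ultimately have "\<exists>g\<in>A. \<forall>x\<in>F n. \<bar>g x - f x\<bar> < 1 / real (Suc n)" for n
    using in_closure_pointwiseD[OF f] by simp
  then obtain g where g: "\<And>n. g n \<in> A" "\<And>n x. x \<in> F n \<Longrightarrow> \<bar>g n x - f x\<bar> < 1 / real (Suc n)"
    by metis
  show ?thesis
  proof (rule that[of g])
    fix x assume x: "x \<in> C"
    have ev: "\<forall>\<^sub>F n in sequentially. norm (g n x - f x) \<le> 1 / real (Suc n)"
      using eventually_ge_at_top[of "to_nat_on C x"]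
    proof eventually_elim
      case (elim n)
      then show ?case using x g(2)[of x n] by (auto simp: F_def)
    qed
    have "(\<lambda>n. g n x - f x) \<longlonglongrightarrow> 0"
      by (rule Lim_null_comparison[OF ev LIMSEQ_Suc[OF lim_1_over_n]])
    then show "(\<lambda>n. g n x) \<longlonglongrightarrow> f x"
      by (simp add: LIM_zero_iff)
  qed (use g in auto)
qed

text \<open>The hypothesis on \<open>A\<close> in \<open>g_space\<close>. It is relative countable
  compactness: accumulation points may lie anywhere in \<open>Z\<close>, outside \<open>A\<close> as
  well.\<close>

definition countably_compact_in :: "'b topology \<Rightarrow> 'b set \<Rightarrow> bool" where
  "countably_compact_in Z A \<longleftrightarrow>
     A \<subseteq> topspace Z \<and> (\<forall>B. B \<subseteq> A \<and> infinite B \<longrightarrow> Z derived_set_of B \<noteq> {})"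

lemma g_space_iff:
  "g_space Z \<longleftrightarrow> (\<forall>A. countably_compact_in Z A \<longrightarrow> compactin Z (Z closure_of A))"
  by (auto simp: g_space_def countably_compact_in_def)

text \<open>Turns accumulation points of sets into cluster points of sequences. A sequence of finite
  range repeats some value infinitely often; otherwise, by the Hausdorff property, each
  neighbourhood of an accumulation point of the range contains infinitely many terms.\<close>

lemma countably_compact_in_pointwise_sequence:
  fixes g :: "nat \<Rightarrow> 'b \<Rightarrow> real"
  assumes A: "countably_compact_in (subtopology (pointwise T) S) A" and g: "\<And>n. g n \<in> A"
  obtains h where "h \<in> S"
    "\<And>F e. \<lbrakk>finite F; F \<subseteq> T; e > 0\<rbrakk> \<Longrightarrow> infinite {n. \<forall>x\<in>F. \<bar>g n x - h x\<bar> < e}"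
proof (cases "finite (range g)")
  case True
  then obtain h where h: "h \<in> range g" "infinite (g -` {h})"
    using inf_img_fin_dom[of g UNIV] by auto
  have "infinite {n. \<forall>x\<in>F. \<bar>g n x - h x\<bar> < e}" if "e > 0" for F and e :: real
    by (rule infinite_super[OF _ h(2)]) (use that in auto)
  moreover have "h \<in> S" using h g A by (auto simp: countably_compact_in_def)
  ultimately show ?thesis using that by blast
next
  case False
  let ?Z = "subtopology (pointwise T) S"
  have H: "Hausdorff_space ?Z"
    by (simp add: Hausdorff_space_subtopology Hausdorff_pointwise)
  have "range g \<subseteq> A" using g by auto
  with A False have "?Z derived_set_of range g \<noteq> {}"
    by (simp only: countably_compact_in_def simp_thms)
  then obtain h where h: "h \<in> topspace ?Z"
      "\<And>U. \<lbrakk>h \<in> U; openin ?Z U\<rbrakk> \<Longrightarrow> infinite (range g \<inter> U)"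
    unfolding derived_set_of_infinite_openin[OF H] by blast
  have "infinite {n. \<forall>x\<in>F. \<bar>g n x - h x\<bar> < e}" if F: "finite F" "F \<subseteq> T" "e > 0" for F e
  proof
    let ?U = "{g \<in> extensional T. \<forall>x\<in>F. \<bar>g x - h x\<bar> < e}"
    assume "finite {n. \<forall>x\<in>F. \<bar>g n x - h x\<bar> < e}"
    then have "finite (g ` {n. \<forall>x\<in>F. \<bar>g n x - h x\<bar> < e})" by blast
    then have "finite (range g \<inter> (?U \<inter> S))"
      by (rule rev_finite_subset) auto
    moreover have "openin ?Z (?U \<inter> S)"
      using openin_pointwise_ball[OF F(1,2)] by (auto simp: openin_subtopology)
    ultimately show False
      using h F(3) by (auto simp: PiE_def)
  qed
  moreover have "h \<in> S" using h(1) by simp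
  ultimately show ?thesis using that by blast
qed

lemma cluster_value_eq:
  fixes u :: "nat \<Rightarrow> real"
  assumes "\<And>e. e > 0 \<Longrightarrow> infinite {n. \<bar>u n - a\<bar> < e}" "u \<longlonglongrightarrow> b"
  shows "a = b"
proof (rule ccontr)
  assume "a \<noteq> b"
  define e where "e = \<bar>a - b\<bar> / 2"
  have "e > 0" using \<open>a \<noteq> b\<close> by (simp add: e_def)
  then have "\<forall>\<^sub>F n in sequentially. \<bar>u n - b\<bar> < e"
    using assms(2) by (auto simp: tendsto_iff dist_real_def)
  moreover have "\<exists>\<^sub>F n in sequentially. \<bar>u n - a\<bar> < e"
    using assms(1)[OF \<open>e > 0\<close>]
    by (simp add: frequently_cofinite cofinite_eq_sequentially[symmetric])
  ultimately have "\<exists>\<^sub>F n in sequentially. \<bar>u n - b\<bar> < e \<and> \<bar>u n - a\<bar> < e"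
    by (auto elim: frequently_rev_mp eventually_mono)
  then obtain n where "\<bar>u n - b\<bar> < e \<and> \<bar>u n - a\<bar> < e"
    using frequently_ex by blast
  then have "\<bar>a - b\<bar> < e + e"
    using abs_triangle_ineq[of "a - u n" "u n - b"] by (simp add: abs_minus_commute)
  then show False by (simp add: e_def)
qed

text \<open>If the values at \<open>x\<close> were unbounded, some sequence in \<open>A\<close>
  would have values there of absolute value above \<open>n\<close>, yet infinitely many of them
  within 1 of the value of a cluster point.\<close>

lemma countably_compact_in_pointwise_bounded:
  assumes A: "countably_compact_in (subtopology (pointwise T) S) A" and x: "x \<in> T"
  shows "\<exists>b. \<forall>g\<in>A. \<bar>g x\<bar> \<le> b"
proof (rule ccontr)
  assume "\<nexists>b. \<forall>g\<in>A. \<bar>g x\<bar> \<le> b"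
  then have "\<exists>g\<in>A. \<bar>g x\<bar> > real n" for n
    by (meson not_le)
  then obtain g where g: "\<And>n. g n \<in> A" "\<And>n. \<bar>g n x\<bar> > real n"
    by metis
  obtain h where h: "\<And>F e. \<lbrakk>finite F; F \<subseteq> T; e > 0\<rbrakk> \<Longrightarrow> infinite {n. \<forall>x\<in>F. \<bar>g n x - h x\<bar> < e}"
    using countably_compact_in_pointwise_sequence[where g=g, OF A g(1)] by blast
  have "infinite {n. \<bar>g n x - h x\<bar> < 1}"
    using h[of "{x}" 1] x by auto
  moreover have "{n. \<bar>g n x - h x\<bar> < 1} \<subseteq> {.. nat \<lceil>\<bar>h x\<bar> + 1\<rceil>}"
  proof
    fix n assume "n \<in> {n. \<bar>g n x - h x\<bar> < 1}"
    then have "real n < \<bar>h x\<bar> + 1" using g(2)[of n] by auto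
    then show "n \<in> {.. nat \<lceil>\<bar>h x\<bar> + 1\<rceil>}" by simp linarith
  qed
  ultimately show False using finite_subset by blast
qed

text \<open>The pointwise bounds place \<open>A\<close> inside a product of compact
  intervals.\<close>

lemma compactin_closure_pointwise:
  assumes A: "countably_compact_in (subtopology (pointwise T) S) A"
  shows "compactin (pointwise T) (pointwise T closure_of A)"
proof -
  obtain b where b: "\<And>x g. \<lbrakk>x \<in> T; g \<in> A\<rbrakk> \<Longrightarrow> \<bar>g x\<bar> \<le> b x"
    using countably_compact_in_pointwise_bounded[OF A] by metis
  let ?K = "\<Pi>\<^sub>E x\<in>T. {- b x..b x}"
  have K: "compactin (pointwise T) ?K"
    by (simp add: compactin_PiE)
  have "A \<subseteq> extensional T"
    using A by (auto simp: countably_compact_in_def PiE_def)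
  then have "A \<subseteq> ?K"
    using b by (auto simp: PiE_def abs_le_iff minus_le_iff subset_iff)
  then have "pointwise T closure_of A \<subseteq> ?K"
    by (intro closure_of_minimal compactin_imp_closedin[OF Hausdorff_pointwise] K)
  then show ?thesis
    by (intro closed_compactin[OF K] closedin_closure_of)
qed

text \<open>Continuity is tested on closures of sets. Tightness reduces the test to a countable
  \<open>B\<close>, and on \<open>insert x B\<close> the function \<open>f\<close> coincides with a
  cluster point \<open>h\<close> in \<open>S\<close>, which is continuous.\<close>

lemma closure_pointwise_continuous:
  assumes tight: "countable_tightness Z" and S: "S \<subseteq> topspace (Cp Z)"
    and A: "countably_compact_in (subtopology (pointwise (topspace Z)) S) A"
    and f: "f \<in> pointwise (topspace Z) closure_of A"
  shows "continuous_map Z euclideanreal f"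
  unfolding continuous_map_eq_image_closure_subset_alt
proof (intro allI impI Pi_I)
  fix D x assume D: "D \<subseteq> topspace Z" and x: "x \<in> Z closure_of D"
  obtain B where B: "B \<subseteq> D" "countable B" "x \<in> Z closure_of B"
    using tight[unfolded countable_tightness_def, rule_format, of D x] D x by blast
  have xT: "x \<in> topspace Z" using x by (simp add: in_closure_of)
  have "countable (insert x B)" "insert x B \<subseteq> topspace Z"
    using B D xT by auto
  then obtain g where g: "\<And>n. g n \<in> A" "\<And>y. y \<in> insert x B \<Longrightarrow> (\<lambda>n. g n y) \<longlonglongrightarrow> f y"
    using in_closure_pointwise_sequence[OF f] by metis
  obtain h where h: "h \<in> S"
      "\<And>F e. \<lbrakk>finite F; F \<subseteq> topspace Z; e > 0\<rbrakk> \<Longrightarrow> infinite {n. \<forall>x\<in>F. \<bar>g n x - h x\<bar> < e}"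
    using countably_compact_in_pointwise_sequence[where g=g, OF A g(1)] by blast
  have hf: "h y = f y" if y: "y \<in> insert x B" for y
  proof (rule cluster_value_eq)
    show "infinite {n. \<bar>g n y - h y\<bar> < e}" if "e > 0" for e
      using h(2)[of "{y}" e] that y xT B D by auto
  qed (use g y in auto)
  have "continuous_map Z euclideanreal h" using h(1) S by (auto simp: topspace_Cp)
  then have "h x \<in> euclideanreal closure_of (h ` B)"
    using B(3) unfolding continuous_map_eq_image_closure_subset by blast
  moreover have "h ` B = f ` B" "h x = f x" using hf by auto
  ultimately show "f x \<in> euclideanreal closure_of (f ` D)"
    using closure_of_mono[of "f ` B" "f ` D" euclideanreal] B(1) by auto
qed

section \<open>Clopen families in Grothendieck spaces\<close>

text \<open>The characteristic functions of the countable subunions form a countably compact family that is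
  dense in the set of characteristic functions of all subunions. In a Grothendieck space it is
  therefore compact, so it contains the characteristic function of the whole union.\<close>

lemma grothendieck_countable_clopen_family:
  fixes C :: "'e \<Rightarrow> 'b set"
  assumes Z: "grothendieck Z"
    and disj: "disjoint_family_on C E" and ne: "\<And>y. y \<in> E \<Longrightarrow> C y \<noteq> {}"
    and clopen: "\<And>B. \<lbrakk>B \<subseteq> E; countable B\<rbrakk> \<Longrightarrow> openin Z (\<Union>y\<in>B. C y) \<and> closedin Z (\<Union>y\<in>B. C y)"
  shows "countable E"
proof -
  let ?T = "topspace Z"
  \<comment> \<open>Spreads a function on the index set over the family: the value
    \<open>u y\<close> on all of \<open>C y\<close>, and 0 off the union. Disjointness makes the
    index unique.\<close>
  define \<phi> :: "('e \<Rightarrow> real) \<Rightarrow> 'b \<Rightarrow> real" where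
    "\<phi> u = (\<lambda>x\<in>?T. if \<exists>y\<in>E. x \<in> C y then u (THE y. y \<in> E \<and> x \<in> C y) else 0)" for u
  have the_eq: "(THE y. y \<in> E \<and> x \<in> C y) = y" if "y \<in> E" "x \<in> C y" for x y
    using that disj by (intro the_equality) (auto simp: disjoint_family_on_def)
  have CT: "C y \<subseteq> ?T" if "y \<in> E" for y
    using clopen[of "{y}"] that openin_subset by fastforce
  have \<phi>_in: "\<phi> u x = u y" if "y \<in> E" "x \<in> C y" for u x y
    using that CT the_eq by (auto simp: \<phi>_def)
  have \<phi>_out: "\<phi> u x = 0" if "x \<in> ?T" "\<not> (\<exists>y\<in>E. x \<in> C y)" for u x
    using that by (auto simp: \<phi>_def)
  have cont\<phi>: "continuous_map (pointwise E) (pointwise ?T) \<phi>"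
  proof -
    have "continuous_map (pointwise E) euclideanreal (\<lambda>u. \<phi> u x)" if x: "x \<in> ?T" for x
    proof (cases "\<exists>y\<in>E. x \<in> C y")
      case True
      then obtain y where "y \<in> E" "x \<in> C y" by blast
      then show ?thesis
        using continuous_map_product_projection[of y E "\<lambda>_. euclideanreal"] by (simp add: \<phi>_in)
    next
      case False
      then show ?thesis using x by (simp add: \<phi>_out)
    qed
    then show ?thesis
      by (auto simp: continuous_map_componentwise \<phi>_def)
  qed
  \<comment> \<open>The compact cube of 0-1 functions supported in \<open>B\<close>. Its image under
    \<open>\<phi>\<close> for countable \<open>B\<close> consists of characteristic functions of
    countable subunions.\<close>
  define V where "V B = (\<Pi>\<^sub>E y\<in>E. if y \<in> B then {0, 1::real} else {0})" for B
  have cV: "compactin (pointwise E) (V B)" for B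
    by (simp add: V_def compactin_PiE)
  have VV: "V B \<subseteq> V B'" if "B \<subseteq> B'" for B B'
    unfolding V_def by (rule PiE_mono) (use that in auto)
  define G where "G = (\<Union>B\<in>{B. B \<subseteq> E \<and> countable B}. \<phi> ` V B)"
  have G_Cp: "G \<subseteq> topspace (Cp Z)"
  proof
    fix f assume "f \<in> G"
    then obtain B u where B: "B \<subseteq> E" "countable B" and u: "u \<in> V B" and f: "f = \<phi> u"
      by (auto simp: G_def)
    define B' where "B' = {y \<in> B. u y = 1}"
    have B': "B' \<subseteq> E" "countable B'"
      using B by (auto simp: B'_def)
    have u01: "u y = (if y \<in> B' then 1 else 0)" if "y \<in> E" for y
      using u that by (fastforce simp: V_def B'_def PiE_def Pi_def split: if_splits)
    have f_eq: "f x = (if x \<in> (\<Union>y\<in>B'. C y) then 1 else 0)" if x: "x \<in> ?T" for x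
    proof (cases "\<exists>y\<in>E. x \<in> C y")
      case True
      then obtain y where y: "y \<in> E" "x \<in> C y" by blast
      have "y = y'" if "y' \<in> B'" "x \<in> C y'" for y'
        using that the_eq[OF y] the_eq[of y' x] B' by auto
      then have "x \<in> (\<Union>y\<in>B'. C y) \<longleftrightarrow> y \<in> B'" using y by blast
      then show ?thesis using y by (simp add: f \<phi>_in u01)
    next
      case False
      then show ?thesis using x B' by (auto simp: f \<phi>_out)
    qed
    have "continuous_map Z euclideanreal f"
    proof (rule continuous_map_eq)
      show "continuous_map Z euclideanreal (\<lambda>x. if x \<in> (\<Union>y\<in>B'. C y) then 1 else 0)"
        unfolding continuous_map_def
      proof (intro conjI allI impI)
        fix U :: "real set"
        let ?D = "\<Union>y\<in>B'. C y"
        have D: "openin Z ?D" "openin Z (?T - ?D)" "?D \<subseteq> ?T"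
          using clopen[OF B'] openin_subset by auto
        have "{x \<in> ?T. (if x \<in> ?D then 1 else 0) \<in> U} =
              (if 1 \<in> U then ?D else {}) \<union> (if 0 \<in> U then ?T - ?D else {})"
          using D(3) by auto
        then show "openin Z {x \<in> ?T. (if x \<in> ?D then 1 else 0) \<in> U}"
          using D by auto
      qed auto
    qed (simp add: f_eq)
    moreover have "f \<in> extensional ?T" by (simp add: f \<phi>_def)
    ultimately show "f \<in> topspace (Cp Z)" by (simp add: topspace_Cp)
  qed
  let ?Z = "subtopology (pointwise ?T) G"
  have topZ: "topspace ?Z = G"
    using G_Cp by (auto simp: topspace_Cp PiE_def)
  have "countably_compact_in ?Z G"
    unfolding countably_compact_in_def
  proof (intro conjI allI impI)
    fix H assume H: "H \<subseteq> G \<and> infinite H"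
    then obtain H' where H': "H' \<subseteq> H" "countable H'" "infinite H'"
      using infinite_countable_subset'[of H] by blast
    have "\<forall>f\<in>H'. \<exists>B. B \<subseteq> E \<and> countable B \<and> f \<in> \<phi> ` V B"
      using H H' by (auto simp: G_def subset_iff)
    then obtain B where B: "\<And>f. f \<in> H' \<Longrightarrow> B f \<subseteq> E \<and> countable (B f) \<and> f \<in> \<phi> ` V (B f)"
      by metis
    \<comment> \<open>Countably many functions have their supports in one countable set, hence lie
      in the compact image of a single cube.\<close>
    let ?B = "\<Union>f\<in>H'. B f"
    have "?B \<subseteq> E" "countable ?B" using B H' by auto
    then have sub: "\<phi> ` V ?B \<subseteq> G" by (auto simp: G_def)
    have "H' \<subseteq> \<phi> ` V ?B"
    proof
      fix f assume "f \<in> H'"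
      then show "f \<in> \<phi> ` V ?B" using B[of f] VV[of "B f" ?B] by blast
    qed
    moreover have "compactin ?Z (\<phi> ` V ?B)"
      using image_compactin[OF cV cont\<phi>] sub by (simp add: compactin_subtopology)
    ultimately have "?Z derived_set_of H' \<noteq> {}"
      using compactin_imp_Bolzano_Weierstrass[of ?Z "\<phi> ` V ?B" H'] H' by blast
    then show "?Z derived_set_of H \<noteq> {}"
      using derived_set_of_mono[OF H'(1), of ?Z] by blast
  qed (simp only: topZ order_refl)
  moreover have "g_space ?Z"
    using Z G_Cp subtopology_Cp[OF G_Cp] unfolding grothendieck_def by metis
  ultimately have "compactin ?Z (?Z closure_of G)"
    unfolding g_space_iff by blast
  then have "compactin (pointwise ?T) G"
    using closure_of_topspace[of ?Z] by (simp only: topZ compactin_subtopology)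
  then have closed: "closedin (pointwise ?T) G"
    by (rule compactin_imp_closedin[OF Hausdorff_pointwise])
  \<comment> \<open>\<open>\<phi> one\<close> is the characteristic function of the whole union. A
    basic neighbourhood of \<open>one\<close> restricts only finitely many coordinates, so it
    contains a function of finite support.\<close>
  define one where "one = (\<lambda>y\<in>E. 1::real)"
  have "one \<in> pointwise E closure_of (\<Union>B\<in>{B. B \<subseteq> E \<and> countable B}. V B)"
    unfolding in_closure_of
  proof (intro conjI allI impI)
    show "one \<in> topspace (pointwise E)" by (simp add: one_def)
    fix W assume W: "one \<in> W \<and> openin (pointwise E) W"
    then obtain U where U: "finite {y \<in> E. U y \<noteq> UNIV}" "one \<in> Pi\<^sub>E E U" "Pi\<^sub>E E U \<subseteq> W"
      unfolding openin_product_topology_alt by (metis (no_types, lifting) Collect_cong topspace_euclidean)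
    define B where "B = {y \<in> E. U y \<noteq> UNIV}"
    define u where "u = (\<lambda>y\<in>E. if y \<in> B then 1 else 0::real)"
    have "u \<in> Pi\<^sub>E E U"
      using U(2) by (auto simp: u_def B_def one_def PiE_def Pi_def)
    moreover have "u \<in> V B" by (auto simp: u_def V_def)
    moreover have "B \<subseteq> E" "countable B"
      using U(1) by (auto simp: B_def intro: countable_finite)
    ultimately show "\<exists>u. u \<in> (\<Union>B\<in>{B. B \<subseteq> E \<and> countable B}. V B) \<and> u \<in> W"
      using U(3) by blast
  qed
  then have "\<phi> one \<in> pointwise ?T closure_of (\<phi> ` (\<Union>B\<in>{B. B \<subseteq> E \<and> countable B}. V B))"
    using continuous_map_image_closure_subset[OF cont\<phi>] by blast
  moreover have "\<phi> ` (\<Union>B\<in>{B. B \<subseteq> E \<and> countable B}. V B) = G"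
    by (simp add: G_def image_UN)
  ultimately have "\<phi> one \<in> G"
    using closed closure_of_eq by metis
  then obtain B u where B: "countable B" "u \<in> V B" "\<phi> one = \<phi> u"
    by (auto simp: G_def)
  have "E \<subseteq> B"
  proof
    fix y assume y: "y \<in> E"
    then obtain x where x: "x \<in> C y" using ne by blast
    then have "u y = 1"
      using fun_cong[OF B(3), of x] y by (simp add: \<phi>_in one_def)
    then show "y \<in> B" using B(2) y by (auto simp: V_def PiE_def Pi_def split: if_splits)
  qed
  then show ?thesis using B(1) countable_subset by blast
qed

section \<open>Countable products of almost discrete spaces\<close>

declare topspace_product_topology [simp del]

locale almost_discrete_sequence =
  fixes X :: "nat \<Rightarrow> 'a topology" and p :: "nat \<Rightarrow> 'a"
  assumes t1: "\<And>i. t1_space (X i)"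
    and regular: "\<And>i. regular_space (X i)"
    and p_in: "\<And>i. p i \<in> topspace (X i)"
    and isolated: "\<And>i x. \<lbrakk>x \<in> topspace (X i); x \<noteq> p i\<rbrakk> \<Longrightarrow> openin (X i) {x}"
begin

abbreviation "P \<equiv> product_topology X UNIV"

lemma topspace_P: "x \<in> topspace P \<longleftrightarrow> (\<forall>i. x i \<in> topspace (X i))"
  by (auto simp: topspace_product_topology PiE_def Pi_def)

lemma openin_P_box:
  assumes "openin P U" "x \<in> U"
  shows "\<exists>n V. (\<forall>i. openin (X i) (V i)) \<and> (\<forall>i. x i \<in> V i) \<and> (\<forall>i\<ge>n. V i = topspace (X i)) \<and>
    {y. \<forall>i. y i \<in> V i} \<subseteq> U"
proof -
  obtain V where V: "finite {i. V i \<noteq> topspace (X i)}" "\<And>i. openin (X i) (V i)"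
      "x \<in> Pi\<^sub>E UNIV V" "Pi\<^sub>E UNIV V \<subseteq> U"
    using assms unfolding openin_product_topology_alt by (metis (no_types, lifting) Collect_cong UNIV_I)
  obtain n where "\<forall>i\<in>{i. V i \<noteq> topspace (X i)}. i < n"
    using V(1) finite_nat_set_iff_bounded by blast
  then have "V i = topspace (X i)" if "i \<ge> n" for i
    using that by (metis (mono_tags, lifting) mem_Collect_eq not_le)
  then show ?thesis
    using V by (intro exI[of _ n] exI[of _ V]) (auto simp: PiE_def)
qed

lemma openin_finite_box:
  assumes "finite J" "\<And>i. i \<in> J \<Longrightarrow> openin (X i) (V i)"
  shows "openin P {z \<in> topspace P. \<forall>i\<in>J. z i \<in> V i}"
proof (cases "J = {}")
  case True
  then show ?thesis by simp
next
  case False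
  have "openin P (\<Inter>i\<in>J. {z \<in> topspace P. z i \<in> V i})"
    using assms False
    by (intro openin_INT2 openin_continuous_map_preimage[OF continuous_map_product_projection]) auto
  moreover have "(\<Inter>i\<in>J. {z \<in> topspace P. z i \<in> V i}) = {z \<in> topspace P. \<forall>i\<in>J. z i \<in> V i}"
    using False by auto
  ultimately show ?thesis by simp
qed

lemma regular_P: "regular_space P"
  using regular by (simp add: regular_space_product_topology)

section \<open>Countable support\<close>

text \<open>All factors share one point type, so a single set \<open>M\<close> serves every
  coordinate and the closing-off runs over sets of points.\<close>

definition collapse :: "'a set \<Rightarrow> (nat \<Rightarrow> 'a) \<Rightarrow> nat \<Rightarrow> 'a" where
  "collapse M x = (\<lambda>i. if x i \<in> M then x i else p i)"

lemma collapse_in: "x \<in> topspace P \<Longrightarrow> collapse M x \<in> topspace P"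
  using p_in unfolding topspace_P by (auto simp: collapse_def)

lemma collapse_collapse: "M \<subseteq> M' \<Longrightarrow> collapse M (collapse M' x) = collapse M x"
  by (auto simp: collapse_def fun_eq_iff)

section \<open>Cocountable neighbourhoods of the non-isolated points\<close>

definition cocountable_nbhds :: bool where
  "cocountable_nbhds \<longleftrightarrow> (\<forall>i U. openin (X i) U \<and> p i \<in> U \<longrightarrow> countable (topspace (X i) - U))"

text \<open>Cover the product by the preimage of \<open>U\<close> and the fibres over the points
  outside \<open>U\<close>. The point \<open>q y\<close> lies in the fibre over \<open>y\<close>
  only, so a countable subcover contains all these fibres, and \<open>THE\<close> recovers
  \<open>y\<close> from its fibre.\<close>

lemma Lindelof_imp_cocountable_nbhds:
  assumes L: "Lindelof_space P"
  shows cocountable_nbhds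
  unfolding cocountable_nbhds_def
proof (intro allI impI)
  fix i U assume U: "openin (X i) U \<and> p i \<in> U"
  let ?pre = "\<lambda>V. {z \<in> topspace P. z i \<in> V}"
  let ?D = "topspace (X i) - U"
  have pre: "openin P (?pre V)" if "openin (X i) V" for V
    using that by (intro openin_continuous_map_preimage[OF continuous_map_product_projection]) auto
  let ?\<U> = "insert (?pre U) ((\<lambda>y. ?pre {y}) ` ?D)"
  have "openin P W" if "W \<in> ?\<U>" for W
    using that
  proof
    assume "W \<in> (\<lambda>y. ?pre {y}) ` ?D"
    then obtain y where y: "y \<in> ?D" "W = ?pre {y}" by blast
    then have "openin (X i) {y}" using U by (intro isolated) auto
    then show ?thesis using pre y(2) by blast
  qed (use U pre in blast)
  moreover have "\<Union>?\<U> = topspace P"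
    by (auto simp: topspace_P)
  ultimately have "\<exists>\<V>. countable \<V> \<and> \<V> \<subseteq> ?\<U> \<and> \<Union>\<V> = topspace P"
    by (rule Lindelof_spaceD[OF L])
  then obtain \<V> where \<V>: "countable \<V>" "\<V> \<subseteq> ?\<U>" "\<Union>\<V> = topspace P"
    by (elim exE conjE)
  define q where "q y = p(i := y)" for y
  have q: "q y \<in> topspace P" if "y \<in> topspace (X i)" for y
    using that p_in by (simp add: topspace_P q_def)
  have "?D \<subseteq> (\<lambda>W. THE y. \<forall>z\<in>W. z i = y) ` \<V>"
  proof
    fix y assume y: "y \<in> ?D"
    then have "q y \<in> \<Union>\<V>" unfolding \<V>(3) by (intro q) simp
    then obtain W where W: "W \<in> \<V>" "q y \<in> W" by (rule UnionE)
    then have "W = ?pre {y}" using \<V>(2) y by (auto simp: q_def)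
    then have "(THE y. \<forall>z\<in>W. z i = y) = y" using W(2) by auto
    then show "y \<in> (\<lambda>W. THE y. \<forall>z\<in>W. z i = y) ` \<V>" using W(1) by force
  qed
  then show "countable ?D" by (rule countable_subset) (rule countable_image[OF \<V>(1)])
qed

text \<open>Every set \<open>B\<close> of points outside \<open>U\<close> is clopen in the factor:
  its points are isolated, and its complement is \<open>U\<close> together with isolated points.
  Hence subunions of the fibres are clopen.\<close>

lemma grothendieck_imp_cocountable_nbhds:
  assumes G: "grothendieck P"
  shows cocountable_nbhds
  unfolding cocountable_nbhds_def
proof (intro allI impI)
  fix i U assume U: "openin (X i) U \<and> p i \<in> U"
  let ?C = "\<lambda>y. {z \<in> topspace P. z i = y}"
  let ?D = "topspace (X i) - U"
  show "countable ?D"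
  proof (rule grothendieck_countable_clopen_family[OF G])
    show "disjoint_family_on ?C ?D" by (auto simp: disjoint_family_on_def)
    show "?C y \<noteq> {}" if "y \<in> ?D" for y
    proof -
      have "p(i := y) \<in> ?C y"
        using that p_in by (simp add: topspace_P)
      then show ?thesis by blast
    qed
    fix B assume B: "B \<subseteq> ?D" "countable B"
    have sing: "openin (X i) (\<Union>y\<in>Y. {y})" if "Y \<subseteq> topspace (X i) - {p i}" for Y
      using that by (intro openin_Union) (auto intro: isolated)
    have "openin (X i) B"
      using sing[of B] B U by auto
    moreover have "closedin (X i) B"
    proof -
      have "topspace (X i) - B = U \<union> (\<Union>y\<in>topspace (X i) - B - {p i}. {y})"
        using B U openin_subset by fastforce
      then have "openin (X i) (topspace (X i) - B)"
        using U sing[of "topspace (X i) - B - {p i}"] openin_Un by (metis Diff_mono Diff_subset order_refl)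
      then show ?thesis using B by (auto simp: closedin_def)
    qed
    moreover have "(\<Union>y\<in>B. ?C y) = {z \<in> topspace P. z i \<in> B}" by auto
    ultimately show "openin P (\<Union>y\<in>B. ?C y) \<and> closedin P (\<Union>y\<in>B. ?C y)"
      by (simp add: openin_continuous_map_preimage[OF continuous_map_product_projection]
        closedin_continuous_map_preimage[OF continuous_map_product_projection])
  qed
qed

text \<open>A finite list is a partial point; the closing-off makes \<open>M\<close> contain, for every list over \<open>M\<close>
  around which some box lies in a member of the cover, the countably many points that such a box
  omits in the coordinates where the list takes the value \<open>p i\<close>.\<close>

lemma open_cover_collapse:
  assumes coc: cocountable_nbhds
    and \<W>: "\<And>W. W \<in> \<W> \<Longrightarrow> openin P W" "topspace P \<subseteq> \<Union>\<W>"
  shows "\<exists>M \<V>. countable M \<and> countable \<V> \<and> \<V> \<subseteq> \<W> \<and>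
    (\<forall>x\<in>topspace P. \<exists>W\<in>\<V>. x \<in> W \<and> collapse M x \<in> W)"
proof -
  \<comment> \<open>\<open>V\<close> is a box around the partial point \<open>s\<close>, restricting
    only the first \<open>length s\<close> coordinates, and \<open>W\<close> is a member of the
    cover that contains this box.\<close>
  define good where "good s V W \<longleftrightarrow> W \<in> \<W> \<and> (\<forall>i<length s. openin (X i) (V i) \<and> s ! i \<in> V i) \<and>
      {z \<in> topspace P. \<forall>i<length s. z i \<in> V i} \<subseteq> W" for s :: "'a list" and V W
  define S where "S = {s. \<exists>V W. good s V W}"
  have "\<forall>s\<in>S. \<exists>V W. good s V W" by (simp add: S_def)
  then obtain V W where VW: "\<And>s. s \<in> S \<Longrightarrow> good s (V s) (W s)" by metis
  define h where "h F = (\<Union>s\<in>lists F \<inter> S. \<Union>i\<in>{i. i < length s \<and> s ! i = p i}. topspace (X i) - V s i)" for F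
  have "countable (h F)" if "finite F" for F
    unfolding h_def
  proof (intro countable_UN)
    show "countable (lists F \<inter> S)"
      using that by (intro countable_Int1 countable_lists countable_finite)
    show "countable (topspace (X i) - V s i)"
      if "s \<in> lists F \<inter> S" "i \<in> {i. i < length s \<and> s ! i = p i}" for s i
    proof -
      have "openin (X i) (V s i)" "p i \<in> V s i"
        using VW[of s] that by (auto simp: good_def)
      then show ?thesis using coc unfolding cocountable_nbhds_def by blast
    qed
  qed auto
  \<comment> \<open>Starting from \<open>range p\<close> puts every coordinate of
    \<open>collapse M x\<close> into \<open>M\<close>.\<close>
  then obtain M where M: "countable M" "range p \<subseteq> M" "\<And>F. \<lbrakk>finite F; F \<subseteq> M\<rbrakk> \<Longrightarrow> h F \<subseteq> M"
    by (rule countable_closing_off[of h "range p"]) auto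
  show ?thesis
  proof (intro exI conjI ballI)
    show "countable M" by fact
    show "countable (W ` (lists M \<inter> S))"
      using M(1) by (intro countable_image countable_Int1 countable_lists)
    show "W ` (lists M \<inter> S) \<subseteq> \<W>"
      using VW by (auto simp: good_def)
    fix x assume x: "x \<in> topspace P"
    define z where "z = collapse M x"
    have z: "z \<in> topspace P" "\<And>i. z i \<in> M"
      using collapse_in[OF x] M(2) by (auto simp: z_def collapse_def)
    then obtain W0 where W0: "W0 \<in> \<W>" "z \<in> W0" using \<W>(2) by blast
    obtain n V0 where V0: "\<forall>i. openin (X i) (V0 i)" "\<forall>i. z i \<in> V0 i"
        "\<forall>i\<ge>n. V0 i = topspace (X i)" "{y. \<forall>i. y i \<in> V0 i} \<subseteq> W0"
      using openin_P_box[OF \<W>(1)[OF W0(1)] W0(2)] by (elim exE conjE)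
    define s where "s = map z [0..<n]"
    have "y \<in> W0" if y: "y \<in> topspace P" "\<forall>i<n. y i \<in> V0 i" for y
    proof -
      have "y i \<in> V0 i" for i
        using y V0(3) by (cases "i < n") (auto simp: topspace_P)
      then show ?thesis using V0(4) by blast
    qed
    \<comment> \<open>\<open>V0\<close> and \<open>W0\<close> serve only to show that
      \<open>s\<close> is in \<open>S\<close>. The argument continues with the chosen
      \<open>V s\<close> and \<open>W s\<close>, which depend on \<open>s\<close> alone; over a
      countable \<open>M\<close> there are countably many of these.\<close>
    then have "good s V0 W0"
      using W0 V0 by (auto simp: good_def s_def)
    then have s: "s \<in> S" "s \<in> lists M"
      using z(2) by (auto simp: S_def s_def)
    have "s \<in> lists (set s)" by auto
    then have hs: "topspace (X i) - V s i \<subseteq> M" if "i < n" "s ! i = p i" for i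
    proof -
      have "topspace (X i) - V s i \<subseteq> h (set s)"
        unfolding h_def using \<open>s \<in> lists (set s)\<close> s(1) that
        by (intro SUP_upper2[of s] SUP_upper2[of i]) (auto simp: s_def)
      also have "\<dots> \<subseteq> M" using s(2) by (intro M(3)) auto
      finally show ?thesis .
    qed
    have g: "W s \<in> \<W>" "\<And>i. i < n \<Longrightarrow> z i \<in> V s i"
        "\<And>y. \<lbrakk>y \<in> topspace P; \<And>i. i < n \<Longrightarrow> y i \<in> V s i\<rbrakk> \<Longrightarrow> y \<in> W s"
      using VW[OF s(1)] by (auto simp: good_def s_def)
    \<comment> \<open>A coordinate in \<open>M\<close> is unchanged by the collapse. Any other
      collapses to \<open>p i\<close>, and there all points omitted by \<open>V s i\<close> belong
      to \<open>M\<close>.\<close>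
    have "x i \<in> V s i" if i: "i < n" for i
    proof (cases "x i \<in> M")
      case True
      then show ?thesis using g(2)[OF i] by (simp add: z_def collapse_def)
    next
      case False
      then have "s ! i = p i" using i by (simp add: s_def z_def collapse_def)
      then show ?thesis using hs[OF i] False x topspace_P by blast
    qed
    then have "x \<in> W s" "z \<in> W s" using g x z by auto
    then show "\<exists>W'\<in>W ` (lists M \<inter> S). x \<in> W' \<and> collapse M x \<in> W'"
      using s unfolding z_def by blast
  qed
qed

lemma cocountable_nbhds_imp_Lindelof:
  assumes cocountable_nbhds
  shows "Lindelof_space P"
  unfolding Lindelof_space_alt
proof (intro allI impI)
  fix \<U> assume "(\<forall>U\<in>\<U>. openin P U) \<and> topspace P \<subseteq> \<Union>\<U>"
  then have "\<exists>M \<V>. countable M \<and> countable \<V> \<and> \<V> \<subseteq> \<U> \<and>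
      (\<forall>x\<in>topspace P. \<exists>W\<in>\<V>. x \<in> W \<and> collapse M x \<in> W)"
    by (intro open_cover_collapse[OF assms]) auto
  then obtain M \<V> where \<V>: "countable \<V>" "\<V> \<subseteq> \<U>"
      "\<forall>x\<in>topspace P. \<exists>W\<in>\<V>. x \<in> W \<and> collapse M x \<in> W"
    by (elim exE conjE)
  have "topspace P \<subseteq> \<Union>\<V>"
  proof
    fix x assume "x \<in> topspace P"
    from bspec[OF \<V>(3) this] show "x \<in> \<Union>\<V>" by blast
  qed
  with \<V>(1,2) show "\<exists>\<V>. countable \<V> \<and> \<V> \<subseteq> \<U> \<and> topspace P \<subseteq> \<Union>\<V>"
    by (intro exI conjI)
qed

text \<open>Applied to preimages of small balls, the covering lemma gives for each \<open>k\<close>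
  a countable set whose collapse changes \<open>f\<close> by less than \<open>2 / (k + 1)\<close>;
  their union works. Allowing every larger \<open>M'\<close> lets the supports be absorbed in a
  later closing-off.\<close>

lemma continuous_countable_support:
  assumes coc: cocountable_nbhds and f: "continuous_map P euclideanreal f"
  shows "\<exists>M. countable M \<and> (\<forall>M' x. M \<subseteq> M' \<and> x \<in> topspace P \<longrightarrow> f (collapse M' x) = f x)"
proof -
  have "\<exists>M. countable M \<and> (\<forall>x\<in>topspace P. \<bar>f x - f (collapse M x)\<bar> < 2 / real (Suc k))" for k
  proof -
    let ?W = "\<lambda>c. {x \<in> topspace P. f x \<in> ball c (1 / real (Suc k))}"
    have "openin P W" if "W \<in> range ?W" for W
      using that openin_continuous_map_preimage[OF f] by (auto simp del: mem_ball)
    moreover have "topspace P \<subseteq> \<Union>(range ?W)"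
    proof
      fix x assume "x \<in> topspace P"
      then have "x \<in> ?W (f x)" by simp
      then show "x \<in> \<Union>(range ?W)" by blast
    qed
    ultimately have "\<exists>M \<V>. countable M \<and> countable \<V> \<and> \<V> \<subseteq> range ?W \<and>
        (\<forall>x\<in>topspace P. \<exists>W\<in>\<V>. x \<in> W \<and> collapse M x \<in> W)"
      by (rule open_cover_collapse[OF coc])
    then obtain M \<V> where M: "countable M" "\<V> \<subseteq> range ?W"
        "\<forall>x\<in>topspace P. \<exists>W\<in>\<V>. x \<in> W \<and> collapse M x \<in> W"
      by (elim exE conjE)
    have "\<bar>f x - f (collapse M x)\<bar> < 2 / real (Suc k)" if x: "x \<in> topspace P" for x
    proof -
      obtain W where W: "W \<in> \<V>" "x \<in> W" "collapse M x \<in> W"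
        using bspec[OF M(3) x] by blast
      then obtain c where "W = ?W c" using M(2) by blast
      then have "x \<in> ?W c" "collapse M x \<in> ?W c" using W by auto
      then have "dist c (f x) < 1 / real (Suc k)" "dist c (f (collapse M x)) < 1 / real (Suc k)" by auto
      then have "dist (f x) (f (collapse M x)) < 1 / real (Suc k) + 1 / real (Suc k)"
        using dist_triangle3[of "f x" "f (collapse M x)" c] by linarith
      then show ?thesis by (simp add: dist_real_def)
    qed
    then show ?thesis using M(1) by blast
  qed
  then obtain M where M: "\<And>k. countable (M k)"
      "\<And>k x. x \<in> topspace P \<Longrightarrow> \<bar>f x - f (collapse (M k) x)\<bar> < 2 / real (Suc k)" by metis
  \<comment> \<open>Both points have the same image under \<open>collapse (M k)\<close>, so each
    value is compared with the value there.\<close>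
  have "f (collapse M' x) = f x" if M': "(\<Union>k. M k) \<subseteq> M'" and x: "x \<in> topspace P" for M' x
  proof -
    have "\<bar>f (collapse M' x) - f x\<bar> \<le> 4 / real (Suc k)" for k
    proof -
      have "collapse (M k) (collapse M' x) = collapse (M k) x"
        using M' by (intro collapse_collapse) auto
      then have "\<bar>f (collapse M' x) - f (collapse (M k) x)\<bar> < 2 / real (Suc k)"
        using M(2)[OF collapse_in[OF x], of M' k] by simp
      moreover have "4 / real (Suc k) = 2 / real (Suc k) + 2 / real (Suc k)" by simp
      ultimately show ?thesis using M(2)[OF x, of k] by linarith
    qed
    moreover have "(\<lambda>k. 4 / real (Suc k)) \<longlonglongrightarrow> 0"
      using tendsto_mult_right_zero[OF LIMSEQ_Suc[OF lim_1_over_n], where c=4] by simp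
    ultimately have "\<bar>f (collapse M' x) - f x\<bar> \<le> 0"
      using LIMSEQ_le_const by (metis (no_types, lifting))
    then show ?thesis by simp
  qed
  then show ?thesis using M(1) by (intro exI[of _ "\<Union>k. M k"]) auto
qed

section \<open>Closures of countably compact sets of functions\<close>

lemma closure_pointwise_subset:
  assumes coc: cocountable_nbhds and tight: "countable_tightness P"
    and S: "S \<subseteq> topspace (Cp P)"
    and A: "countably_compact_in (subtopology (pointwise (topspace P)) S) A"
  shows "pointwise (topspace P) closure_of A \<subseteq> S"
proof
  fix f assume f: "f \<in> pointwise (topspace P) closure_of A"
  have fcont: "continuous_map P euclideanreal f"
    by (rule closure_pointwise_continuous[OF tight S A f])
  have AS: "A \<subseteq> S" using A by (auto simp: countably_compact_in_def)
  have Scont: "continuous_map P euclideanreal g" if "g \<in> S" for g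
    using S that by (auto simp: topspace_Cp)
  have "\<forall>g. continuous_map P euclideanreal g \<longrightarrow>
      (\<exists>M. countable M \<and> (\<forall>M' x. M \<subseteq> M' \<and> x \<in> topspace P \<longrightarrow> g (collapse M' x) = g x))"
    using continuous_countable_support[OF coc] by blast
  then obtain supp where supp: "\<And>g. continuous_map P euclideanreal g \<Longrightarrow> countable (supp g)"
      "\<And>g M x. \<lbrakk>continuous_map P euclideanreal g; supp g \<subseteq> M; x \<in> topspace P\<rbrakk> \<Longrightarrow> g (collapse M x) = g x"
    by metis
  \<comment> \<open>Finite for finite \<open>N\<close>. For countable \<open>M\<close> containing
    \<open>range p\<close>, the sets \<open>Q M k\<close> together are countable and dense in the
    image of \<open>collapse M\<close>.\<close>
  define Q where "Q N n = {z \<in> topspace P. (\<forall>i<n. z i \<in> N) \<and> (\<forall>i\<ge>n. z i = p i)}" for N and n :: nat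
  have Qfin: "finite (Q N n)" if "finite N" for N n
  proof (rule inj_on_finite)
    show "inj_on (\<lambda>z. map z [0..<n]) (Q N n)"
    proof (rule inj_onI, rule ext)
      fix y z i assume "y \<in> Q N n" "z \<in> Q N n" "map y [0..<n] = map z [0..<n]"
      then show "y i = z i" by (cases "i < n") (auto simp: Q_def)
    qed
    show "(\<lambda>z. map z [0..<n]) ` Q N n \<subseteq> {s. set s \<subseteq> N \<and> length s = n}"
      by (auto simp: Q_def)
    show "finite {s. set s \<subseteq> N \<and> length s = n}"
      using that by (rule finite_lists_length_eq)
  qed
  \<comment> \<open>The points \<open>p i\<close> are adjoined because an element of
    \<open>Q M k\<close> must also be tested at stages \<open>n\<close> beyond \<open>k\<close>,
    where its coordinates from \<open>k\<close> on equal \<open>p i\<close>.\<close>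
  have "\<exists>g\<in>A. \<forall>z\<in>Q (N \<union> p ` {..<n}) n. \<bar>g z - f z\<bar> < 1 / real (Suc n)" if "finite N" for N n
    using that by (intro in_closure_pointwiseD[OF f] Qfin) (auto simp: Q_def)
  then obtain g where gA: "\<And>N n. finite N \<Longrightarrow> g N n \<in> A"
    and g: "\<And>N n z. \<lbrakk>finite N; z \<in> Q (N \<union> p ` {..<n}) n\<rbrakk> \<Longrightarrow> \<bar>g N n z - f z\<bar> < 1 / real (Suc n)"
    by metis
  have "countable (\<Union>n. supp (g N n))" if "finite N" for N
    using gA[OF that] AS by (intro countable_UN supp(1) Scont) auto
  moreover have "countable (range p \<union> supp f)"
    using supp(1)[OF fcont] by simp
  ultimately obtain M where M: "countable M" "range p \<union> supp f \<subseteq> M"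
      "\<And>N. \<lbrakk>finite N; N \<subseteq> M\<rbrakk> \<Longrightarrow> (\<Union>n. supp (g N n)) \<subseteq> M"
    by (rule countable_closing_off[of "\<lambda>N. \<Union>n. supp (g N n)" "range p \<union> supp f"]) auto
  have "M \<noteq> {}" using M(2) by auto
  define e where "e = from_nat_into M"
  have e: "range e = M"
    unfolding e_def by (rule range_from_nat_into[OF \<open>M \<noteq> {}\<close> M(1)])
  \<comment> \<open>The approximant for the first \<open>n\<close> points in an enumeration of
    \<open>M\<close>; the closing-off puts its support inside \<open>M\<close>.\<close>
  define u where "u n = g (e ` {..<n}) n" for n
  have uA: "u n \<in> A" for n by (simp add: u_def gA)
  have u_lim: "(\<lambda>n. u n z) \<longlonglongrightarrow> f z" if z: "z \<in> Q M k" for z k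
  proof -
    have "\<forall>i. \<exists>m. z i = e m"
    proof
      fix i
      have "z i \<in> M" using z M(2) by (cases "i < k") (auto simp: Q_def)
      then show "\<exists>m. z i = e m" using e by auto
    qed
    then obtain m where m: "\<And>i. z i = e (m i)" by metis
    \<comment> \<open>The sum bounds all the indices \<open>m i\<close> with \<open>i < k\<close>,
      so from \<open>n0\<close> on every coordinate of \<open>z\<close> is among the tested
      points.\<close>
    define n0 where "n0 = Suc (k + (\<Sum>i<k. m i))"
    have ev: "\<forall>\<^sub>F n in sequentially. norm (u n z - f z) \<le> 1 / real (Suc n)"
      using eventually_ge_at_top[of n0]
    proof eventually_elim
      case (elim n)
      have "z i \<in> e ` {..<n} \<union> p ` {..<n}" if "i < n" for i
      proof (cases "i < k")
        case True
        then have "m i \<le> (\<Sum>i<k. m i)" by (intro member_le_sum) auto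
        then have "m i < n" using elim by (simp add: n0_def)
        then show ?thesis using m[of i] by auto
      next
        case False
        then show ?thesis using z that by (auto simp: Q_def)
      qed
      then have "z \<in> Q (e ` {..<n} \<union> p ` {..<n}) n"
        using z elim by (auto simp: Q_def n0_def)
      then show ?case using g[of "e ` {..<n}" z n] by (simp add: u_def)
    qed
    have "(\<lambda>n. u n z - f z) \<longlonglongrightarrow> 0"
      by (rule Lim_null_comparison[OF ev LIMSEQ_Suc[OF lim_1_over_n]])
    then show ?thesis by (simp add: LIM_zero_iff)
  qed
  obtain h where h: "h \<in> S"
      "\<And>F e. \<lbrakk>finite F; F \<subseteq> topspace P; e > 0\<rbrakk> \<Longrightarrow> infinite {n. \<forall>x\<in>F. \<bar>u n x - h x\<bar> < e}"
    using countably_compact_in_pointwise_sequence[where g=u, OF A uA] by blast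
  have hcont: "continuous_map P euclideanreal h" by (rule Scont[OF h(1)])
  have h_collapse: "h (collapse M x) = h x" if x: "x \<in> topspace P" for x
  proof (rule ccontr)
    assume ne: "h (collapse M x) \<noteq> h x"
    define d where "d = \<bar>h (collapse M x) - h x\<bar> / 2"
    have "d > 0" using ne by (simp add: d_def)
    \<comment> \<open>One and the same \<open>u n\<close> must be close to \<open>h\<close> at both
      points: its invariance under \<open>collapse M\<close> then contradicts the gap between the
      two values of \<open>h\<close>.\<close>
    then have "infinite {n. \<forall>y\<in>{x, collapse M x}. \<bar>u n y - h y\<bar> < d}"
      using x collapse_in by (intro h(2)) auto
    then obtain n where n: "\<bar>u n x - h x\<bar> < d" "\<bar>u n (collapse M x) - h (collapse M x)\<bar> < d"
      using not_finite_existsD by fastforce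
    have "u n \<in> S" using uA AS by auto
    then have "u n (collapse M x) = u n x"
      using M(3)[of "e ` {..<n}"] e by (intro supp(2) x Scont) (auto simp: u_def)
    then have "\<bar>h (collapse M x) - h x\<bar> < d + d" using n by linarith
    then show False by (simp add: d_def)
  qed
  have hQ: "h z = f z" if z: "z \<in> Q M k" for z k
  proof (rule cluster_value_eq)
    show "infinite {n. \<bar>u n z - h z\<bar> < e}" if "e > 0" for e
      using h(2)[of "{z}" e] that z by (auto simp: Q_def)
  qed (rule u_lim[OF z])
  have "h x = f x" if x: "x \<in> topspace P" for x
  proof -
    define z where "z = collapse M x"
    have z: "z \<in> topspace P" "\<And>i. z i \<in> M"
      using collapse_in[OF x] M(2) by (auto simp: z_def collapse_def)
    \<comment> \<open>The points \<open>w k\<close> lie in the sets \<open>Q M k\<close>, where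
      \<open>h\<close> and \<open>f\<close> agree, and converge to \<open>z\<close>.\<close>
    define w where "w k = (\<lambda>i. if i < k then z i else p i)" for k
    have wQ: "w k \<in> Q M k" for k
      using z p_in by (auto simp: Q_def w_def topspace_P)
    have lim: "limitin P w z sequentially"
      unfolding limitin_componentwise
    proof (intro conjI ballI)
      show "\<forall>\<^sub>F k in sequentially. w k \<in> topspace P" using wQ by (simp add: Q_def)
      fix i
      have "\<forall>\<^sub>F k in sequentially. w k i = z i"
        using eventually_gt_at_top[of i] by eventually_elim (simp add: w_def)
      then show "limitin (X i) (\<lambda>k. w k i) (z i) sequentially"
        using z(1) by (intro limitin_eventually) (auto simp: topspace_P)
    qed simp
    have "(h \<circ> w) \<longlonglongrightarrow> h z" "(f \<circ> w) \<longlonglongrightarrow> f z"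
      using continuous_map_limit[OF hcont lim] continuous_map_limit[OF fcont lim] by auto
    moreover have "h \<circ> w = f \<circ> w" using hQ[OF wQ] by auto
    ultimately have "h z = f z" using LIMSEQ_unique by metis
    moreover have "f z = f x" unfolding z_def using M(2) by (intro supp(2) fcont x) auto
    ultimately show ?thesis using h_collapse[OF x] by (simp add: z_def)
  qed
  moreover have "h \<in> extensional (topspace P)" using h(1) S by (auto simp: topspace_Cp)
  moreover have "f \<in> extensional (topspace P)"
    using f by (auto simp: in_closure_of topspace_product_topology PiE_def)
  ultimately have "h = f" by (intro extensionalityI[of h "topspace P" f])
  then show "f \<in> S" using h(1) by simp
qed

lemma grothendieck_if_cocountable_tight:
  assumes coc: cocountable_nbhds and tight: "countable_tightness P"
  shows "grothendieck P"
  unfolding grothendieck_def g_space_iff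
proof (intro allI impI)
  fix S A assume S: "S \<subseteq> topspace (Cp P)" and "countably_compact_in (subtopology (Cp P) S) A"
  then have A: "countably_compact_in (subtopology (pointwise (topspace P)) S) A"
    by (simp add: subtopology_Cp)
  then have "A \<subseteq> S" by (auto simp: countably_compact_in_def)
  have sub: "pointwise (topspace P) closure_of A \<subseteq> S"
    by (rule closure_pointwise_subset[OF coc tight S A])
  have "subtopology (pointwise (topspace P)) S closure_of A = pointwise (topspace P) closure_of A"
    using sub \<open>A \<subseteq> S\<close> by (simp add: closure_of_subtopology inf_absorb2)
  then show "compactin (subtopology (Cp P) S) (subtopology (Cp P) S closure_of A)"
    using sub compactin_closure_pointwise[OF A]
    by (simp add: subtopology_Cp[OF S] compactin_subtopology)
qed

section \<open>Tightness\<close>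

text \<open>A retraction onto a copy, inside \<open>P\<close>, of the subproduct over
  \<open>J\<close>.\<close>

definition truncate :: "nat set \<Rightarrow> (nat \<Rightarrow> 'a) \<Rightarrow> nat \<Rightarrow> 'a" where
  "truncate J z = (\<lambda>i. if i \<in> J then z i else p i)"

lemma truncate_in: "z \<in> topspace P \<Longrightarrow> truncate J z \<in> topspace P"
  using p_in by (auto simp: topspace_P truncate_def)

lemma continuous_truncate: "continuous_map P P (truncate J)"
  unfolding continuous_map_componentwise_UNIV
proof
  fix i
  show "continuous_map P (X i) (\<lambda>z. truncate J z i)"
    using p_in by (cases "i \<in> J") (simp_all add: truncate_def continuous_map_product_projection)
qed

definition carrier_set :: "(nat \<Rightarrow> 'a) \<Rightarrow> nat set" where
  "carrier_set z = {i. z i \<noteq> p i}"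

text \<open>Only coordinates with isolated values are fixed, so a finite carrier makes the cell an
  open neighbourhood of \<open>z\<close>. In it \<open>z\<close> is the only point with its own
  carrier; all others have a larger one.\<close>

definition cell :: "(nat \<Rightarrow> 'a) \<Rightarrow> (nat \<Rightarrow> 'a) set" where
  "cell z = {w \<in> topspace P. \<forall>i\<in>carrier_set z. w i = z i}"

lemma cell_carrier:
  assumes "w \<in> cell z"
  shows "carrier_set z \<subseteq> carrier_set w" "carrier_set w = carrier_set z \<Longrightarrow> w = z"
  using assms by (auto simp: cell_def carrier_set_def fun_eq_iff)

lemma openin_cell:
  assumes "z \<in> topspace P" "finite (carrier_set z)"
  shows "openin P (cell z)"
proof -
  have "openin P {w \<in> topspace P. \<forall>i\<in>carrier_set z. w i \<in> {z i}}"
    using assms by (intro openin_finite_box isolated) (auto simp: carrier_set_def topspace_P)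
  then show ?thesis by (simp add: cell_def)
qed

lemma closedin_cell:
  assumes "z \<in> topspace P"
  shows "closedin P (cell z)"
proof -
  have "closedin P {w \<in> topspace P. w i \<in> {z i}}" for i
    using assms by (intro closedin_continuous_map_preimage[OF continuous_map_product_projection]
        closedin_t1_singleton t1) (auto simp: topspace_P)
  then have "closedin P (topspace P \<inter> (\<Inter>i\<in>carrier_set z. {w \<in> topspace P. w i \<in> {z i}}))"
    by (cases "carrier_set z = {}") (auto intro!: closedin_Int closedin_Inter)
  moreover have "topspace P \<inter> (\<Inter>i\<in>carrier_set z. {w \<in> topspace P. w i \<in> {z i}}) = cell z"
    by (auto simp: cell_def)
  ultimately show ?thesis by simp
qed

text \<open>Induction on the number of coordinates below \<open>n\<close> at which \<open>x\<close> is non-isolated. Near \<open>x\<close> all other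
  limit points of \<open>A\<close> have larger carrier, so by induction no countable set of them clusters at \<open>x\<close>.
  Among the finitely many carriers, a minimal \<open>J\<close> whose limit points cluster at \<open>x\<close> yields a set all of
  whose countable subsets are closed and discrete; the fibres of \<open>truncate J\<close> over it contradict
  \<open>grothendieck_countable_clopen_family\<close>.\<close>

lemma tight_at_finite_carrier:
  assumes G: "grothendieck P"
    and "x \<in> P closure_of A" "carrier_set x \<subseteq> {..<n}"
    and "\<And>a. a \<in> A \<Longrightarrow> a \<in> topspace P \<and> carrier_set a \<subseteq> {..<n}"
  shows "\<exists>B. B \<subseteq> A \<and> countable B \<and> x \<in> P closure_of B"
  using assms(2-)
proof (induction "n - card (carrier_set x)" arbitrary: x rule: less_induct)
  case less
  note A = less.prems(3)
  have xP: "x \<in> topspace P" using less.prems(1) by (simp add: in_closure_of)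
  have finx: "finite (carrier_set x)" using less.prems(2) finite_subset by blast
  \<comment> \<open>A copy of the product of the first \<open>n\<close> factors. Being closed and
    containing \<open>A\<close>, it keeps all limit points of \<open>A\<close> within finite
    carriers.\<close>
  let ?L = "{z \<in> topspace P. carrier_set z \<subseteq> {..<n}}"
  have L: "closedin P ?L"
  proof -
    have "closedin P {z \<in> topspace P. z i \<in> {p i}}" for i
      by (intro closedin_continuous_map_preimage[OF continuous_map_product_projection]
          closedin_t1_singleton t1 p_in) auto
    then have "closedin P (\<Inter>i\<in>{n..}. {z \<in> topspace P. z i \<in> {p i}})"
      by (intro closedin_Inter) auto
    moreover have "(\<Inter>i\<in>{n..}. {z \<in> topspace P. z i \<in> {p i}}) = ?L"
      by (auto simp: carrier_set_def not_less[symmetric])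
    ultimately show ?thesis by simp
  qed
  show ?case
  proof (rule ccontr)
    assume neg: "\<not> ?case"
    then have not_tight: "x \<notin> P closure_of B" if "B \<subseteq> A" "countable B" for B
      using that by blast
    have "x \<notin> A"
    proof
      assume "x \<in> A"
      then have "x \<notin> P closure_of {x}" by (intro not_tight) auto
      then show False using closure_of_subset[of "{x}" P] xP by auto
    qed
    \<comment> \<open>The limit points of \<open>A\<close> near \<open>x\<close> with strictly
      larger carrier, to which the induction hypothesis applies: each is a limit of a countable
      subset of \<open>A\<close>.\<close>
    define A' where "A' = P closure_of A \<inter> ?L \<inter> cell x - {x}"
    have A'_not_tight: "x \<notin> P closure_of B" if B: "B \<subseteq> A'" "countable B" for B
    proof
      assume x: "x \<in> P closure_of B"
      have "\<forall>y\<in>B. \<exists>By. By \<subseteq> A \<and> countable By \<and> y \<in> P closure_of By"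
      proof
        fix y assume "y \<in> B"
        then have y: "y \<in> P closure_of A" "carrier_set y \<subseteq> {..<n}" "y \<in> cell x" "y \<noteq> x"
          using B by (auto simp: A'_def)
        have "carrier_set x \<subset> carrier_set y" using cell_carrier[OF y(3)] y(4) by blast
        then have "card (carrier_set x) < card (carrier_set y)"
          using y(2) finite_subset by (intro psubset_card_mono) auto
        moreover have "card (carrier_set y) \<le> n"
          using card_mono[OF _ y(2)] by simp
        ultimately show "\<exists>By. By \<subseteq> A \<and> countable By \<and> y \<in> P closure_of By"
          using y A by (intro less.hyps) auto
      qed
      then obtain By where By: "\<forall>y\<in>B. By y \<subseteq> A \<and> countable (By y) \<and> y \<in> P closure_of (By y)"
        by metis
      let ?B = "\<Union>y\<in>B. By y"
      have "B \<subseteq> P closure_of ?B"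
      proof
        fix y assume y: "y \<in> B"
        then have "By y \<subseteq> ?B" by blast
        then show "y \<in> P closure_of ?B" using By y closure_of_mono by blast
      qed
      then have "x \<in> P closure_of ?B"
        using x closure_of_mono[of B "P closure_of ?B" P] by auto
      moreover have "?B \<subseteq> A" "countable ?B" using By B(2) by auto
      ultimately show False using not_tight by blast
    qed
    define E where "E J = {y \<in> A'. carrier_set y = J}" for J
    have "x \<in> P closure_of A'"
    proof -
      have "x \<in> cell x" using xP by (simp add: cell_def)
      then have "x \<in> P closure_of (cell x \<inter> A)"
        using openin_Int_closure_of_subset[OF openin_cell[OF xP finx], of A] less.prems(1) by blast
      moreover have "cell x \<inter> A \<subseteq> A'"
        using A \<open>x \<notin> A\<close> closure_of_subset[of A P] by (auto simp: A'_def)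
      ultimately show ?thesis using closure_of_mono by blast
    qed
    moreover have "A' = (\<Union>J\<in>Pow {..<n}. E J)" by (auto simp: E_def A'_def)
    ultimately have "x \<in> (\<Union>J\<in>Pow {..<n}. P closure_of E J)"
      using closure_of_Union[of "E ` Pow {..<n}" P] by simp
    then have "\<exists>J. J \<subseteq> {..<n} \<and> x \<in> P closure_of E J" by blast
    then obtain J where J: "J \<subseteq> {..<n}" "x \<in> P closure_of E J"
      and min: "\<And>J'. \<lbrakk>card J' < card J; J' \<subseteq> {..<n}\<rbrakk> \<Longrightarrow> x \<notin> P closure_of E J'"
      using ex_has_least_nat[of "\<lambda>J. J \<subseteq> {..<n} \<and> x \<in> P closure_of E J" _ card] by (metis not_le)
    have finJ: "finite J" using J(1) finite_subset by blast
    \<comment> \<open>The limits of points with carrier properly inside \<open>J\<close>. As a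
      finite union this set is closed, and it misses \<open>x\<close> by minimality of
      \<open>J\<close>; regularity separates the two by \<open>W\<close>.\<close>
    define bad where "bad = (\<Union>J'\<in>{J'. J' \<subset> J}. P closure_of E J')"
    have "closedin P bad"
      unfolding bad_def using finJ by (intro closedin_Union) (auto intro: finite_subset[of _ "Pow J"])
    moreover have "x \<notin> bad"
      using min J(1) psubset_card_mono[OF finJ] by (auto simp: bad_def)
    ultimately obtain W where W: "openin P W" "x \<in> W" "disjnt bad (P closure_of W)"
      using regular_P xP unfolding regular_space by blast
    define D where "D = W \<inter> E J"
    have xD: "x \<in> P closure_of D"
      using openin_Int_closure_of_subset[OF W(1), of "E J"] W(2) J(2) by (auto simp: D_def)
    have DA': "D \<subseteq> A'" by (auto simp: D_def E_def)
    have DP: "y \<in> topspace P" "carrier_set y = J" if "y \<in> D" for y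
      using that by (auto simp: D_def E_def A'_def)
    \<comment> \<open>A limit \<open>z\<close> of \<open>B\<close> is again in \<open>A'\<close>,
      and its open cell meets \<open>B\<close>, so its carrier lies in \<open>J\<close>. A proper
      subset would put \<open>z\<close> into \<open>bad\<close>, away from the closure of
      \<open>W\<close>; equality forces \<open>z\<close> to be the point of \<open>B\<close> in the
      cell.\<close>
    have closedB: "closedin P B" if B: "B \<subseteq> D" "countable B" for B
    proof -
      have "P closure_of B \<subseteq> B"
      proof
        fix z assume z: "z \<in> P closure_of B"
        have zP: "z \<in> topspace P" using z by (simp add: in_closure_of)
        have "z \<in> P closure_of W" using z closure_of_mono[of B W P] B by (auto simp: D_def)
        have "B \<subseteq> P closure_of A" "B \<subseteq> ?L" "B \<subseteq> cell x" using B DA' by (auto simp: A'_def)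
        then have "z \<in> P closure_of A" "z \<in> ?L" "z \<in> cell x"
          using subsetD[OF closure_of_minimal[OF _ closedin_closure_of] z]
            subsetD[OF closure_of_minimal[OF _ L] z]
            subsetD[OF closure_of_minimal[OF _ closedin_cell[OF xP]] z] by simp_all
        moreover have "x \<notin> P closure_of B" using B DA' by (intro A'_not_tight) auto
        then have "z \<noteq> x" using z by auto
        ultimately have zA': "z \<in> A'" by (simp add: A'_def)
        have "finite (carrier_set z)" using \<open>z \<in> ?L\<close> finite_subset[of "carrier_set z" "{..<n}"] by simp
        then have "openin P (cell z)" by (rule openin_cell[OF zP])
        moreover have "z \<in> cell z" using zP by (simp add: cell_def)
        ultimately obtain y where y: "y \<in> B" "y \<in> cell z"
          using z unfolding in_closure_of by blast
        have cy: "carrier_set y = J" using y B DP by blast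
        have "carrier_set z = J"
        proof (rule ccontr)
          assume "carrier_set z \<noteq> J"
          then have "carrier_set z \<subset> J" using cell_carrier(1)[OF y(2)] cy by auto
          moreover have "E (carrier_set z) \<subseteq> topspace P" by (auto simp: E_def A'_def)
          then have "z \<in> P closure_of E (carrier_set z)"
            using closure_of_subset zA' by (fastforce simp: E_def)
          ultimately have "z \<in> bad" by (auto simp: bad_def)
          then show False using W(3) \<open>z \<in> P closure_of W\<close> by (auto simp: disjnt_iff)
        qed
        then have "y = z" using cell_carrier(2)[OF y(2)] cy by simp
        then show "z \<in> B" using y by simp
      qed
      moreover have "B \<subseteq> topspace P" using B DP by blast
      ultimately show ?thesis using closure_of_subset_eq by blast
    qed
    let ?C = "\<lambda>y. {z \<in> topspace P. truncate J z = y}"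
    \<comment> \<open>The fibre over \<open>y\<close> is the cell of \<open>y\<close>, hence open;
      countable unions of fibres are closed as preimages of the closed sets
      \<open>B\<close>.\<close>
    have trunc_iff: "truncate J z = y \<longleftrightarrow> z \<in> cell y" if "y \<in> D" "z \<in> topspace P" for y z
      using DP[OF that(1)] that(2) by (auto simp: truncate_def cell_def carrier_set_def fun_eq_iff)
    have "countable D"
    proof (rule grothendieck_countable_clopen_family[OF G])
      show "disjoint_family_on ?C D" by (auto simp: disjoint_family_on_def)
      show "?C y \<noteq> {}" if "y \<in> D" for y
      proof -
        have "y \<in> ?C y" using trunc_iff[OF that] DP[OF that] by (simp add: cell_def)
        then show ?thesis by blast
      qed
      fix B assume B: "B \<subseteq> D" "countable B"
      have "(\<Union>y\<in>B. ?C y) = {z \<in> topspace P. truncate J z \<in> B}" by auto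
      then have closed: "closedin P (\<Union>y\<in>B. ?C y)"
        using closedin_continuous_map_preimage[OF continuous_truncate closedB[OF B]] by simp
      have "?C y = cell y" if "y \<in> B" for y
        using trunc_iff[of y] that B by (auto simp: cell_def)
      moreover have "openin P (cell y)" if "y \<in> B" for y
        using that B DP finJ by (intro openin_cell) auto
      ultimately have "openin P (\<Union>y\<in>B. ?C y)" by (intro openin_Union) auto
      with closed show "openin P (\<Union>y\<in>B. ?C y) \<and> closedin P (\<Union>y\<in>B. ?C y)" by blast
    qed
    \<comment> \<open>\<open>D\<close> is now a countable subset of \<open>A'\<close> that clusters
      at \<open>x\<close>.\<close>
    then show False using A'_not_tight[OF DA'] xD by blast
  qed
qed

text \<open>A basic box around \<open>x\<close> restricts only coordinates below some
  \<open>n\<close>, so it meets the countable set \<open>B n\<close> found for the truncation to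
  these coordinates. The union of all \<open>B n\<close> therefore clusters at
  \<open>x\<close>.\<close>

lemma grothendieck_imp_countable_tightness:
  assumes G: "grothendieck P"
  shows "countable_tightness P"
  unfolding countable_tightness_def
proof (intro allI impI)
  fix A x assume Ax: "A \<subseteq> topspace P \<and> x \<in> P closure_of A"
  have "\<exists>B. B \<subseteq> A \<and> countable B \<and> truncate {..<n} x \<in> P closure_of (truncate {..<n} ` B)" for n
  proof -
    let ?t = "truncate {..<n}"
    have "?t x \<in> P closure_of (?t ` A)"
      using continuous_map_image_closure_subset[OF continuous_truncate] Ax by blast
    moreover have "carrier_set (?t z) \<subseteq> {..<n}" for z
      by (auto simp: carrier_set_def truncate_def split: if_splits)
    moreover have "?t a \<in> topspace P" if "a \<in> A" for a
      using that Ax by (intro truncate_in) auto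
    ultimately have "\<exists>B. B \<subseteq> ?t ` A \<and> countable B \<and> ?t x \<in> P closure_of B"
      by (intro tight_at_finite_carrier[OF G, where n=n]) auto
    then obtain B where B: "B \<subseteq> ?t ` A" "countable B" "?t x \<in> P closure_of B" by blast
    then show ?thesis
      using countable_subset_image[of B ?t A] by metis
  qed
  then obtain B where B: "\<And>n. B n \<subseteq> A" "\<And>n. countable (B n)"
      "\<And>n. truncate {..<n} x \<in> P closure_of (truncate {..<n} ` B n)" by metis
  have "x \<in> P closure_of (\<Union>n. B n)"
    unfolding in_closure_of
  proof (intro conjI allI impI)
    show xP: "x \<in> topspace P" using Ax by (simp add: in_closure_of)
    fix U assume U: "x \<in> U \<and> openin P U"
    then obtain n V where V: "\<forall>i. openin (X i) (V i)" "\<forall>i. x i \<in> V i"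
        "\<forall>i\<ge>n. V i = topspace (X i)" "{y. \<forall>i. y i \<in> V i} \<subseteq> U"
      using openin_P_box[of U x] by blast
    let ?V = "{z \<in> topspace P. \<forall>i\<in>{..<n}. z i \<in> V i}"
    have "openin P ?V" using V by (intro openin_finite_box) auto
    moreover have "truncate {..<n} x \<in> ?V"
      using truncate_in[OF xP, of "{..<n}"] V(2) by (simp add: truncate_def)
    ultimately have "\<exists>y. y \<in> truncate {..<n} ` B n \<and> y \<in> ?V"
      using B(3)[of n] unfolding in_closure_of by (elim conjE allE[of _ ?V]) simp
    then obtain b where b: "b \<in> B n" "truncate {..<n} b \<in> ?V" by blast
    have "b i \<in> V i" for i
      using b V(3) Ax B(1)[of n] by (cases "i < n") (auto simp: truncate_def topspace_P subset_iff)
    then show "\<exists>y. y \<in> (\<Union>n. B n) \<and> y \<in> U" using b V(4) by blast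
  qed
  then show "\<exists>B. B \<subseteq> A \<and> countable B \<and> x \<in> P closure_of B"
    using B by (intro exI[of _ "\<Union>n. B n"]) auto
qed

end

theorem theorem61:
  fixes X :: "nat \<Rightarrow> 'a topology"
  assumes "\<And>i. tychonoff_space (X i)"
    and "\<And>i. almost_discrete (X i)"
  shows "grothendieck (product_topology X UNIV) \<longleftrightarrow>
           countable_tightness (product_topology X UNIV) \<and> Lindelof_space (product_topology X UNIV)"
proof -
  have "\<exists>p. \<forall>i. p i \<in> topspace (X i) \<and> (\<forall>x\<in>topspace (X i). x \<noteq> p i \<longrightarrow> openin (X i) {x})"
    using assms(2) unfolding almost_discrete_def by metis
  then obtain p where p: "\<And>i. p i \<in> topspace (X i)"
      "\<And>i x. \<lbrakk>x \<in> topspace (X i); x \<noteq> p i\<rbrakk> \<Longrightarrow> openin (X i) {x}"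
    by blast
  interpret almost_discrete_sequence X p
  proof
    show "t1_space (X i)" "regular_space (X i)" for i
      using assms(1)[of i] completely_regular_imp_regular_space by (auto simp: tychonoff_space_def)
  qed (use p in auto)
  show ?thesis
    using grothendieck_imp_countable_tightness cocountable_nbhds_imp_Lindelof
      grothendieck_imp_cocountable_nbhds Lindelof_imp_cocountable_nbhds grothendieck_if_cocountable_tight
    by blast
qed

end
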